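(* Let $(\Gamma,v_0)$ be a pointed graph with $I(\Gamma,v_0)=\{0,1,2\}$ satisfying the following two conditions: (S1) for every $i\in I(\Gamma,v_0)$ and all $v,w\in V$, $|S_i(v)|=|S_i(w)|$; (S2) for all $i,j,k\in I(\Gamma,v_0)$ and all $v,w\in S_k(v_0)$, $|S_i(v)\cap S_j(v_0)|=|S_i(w)\cap S_j(v_0)|$. Let $\mu_k=|S_k(v_0)|$ for $k=1,2$, and let $m=|S_1(v_1)\cap S_1(v_0)|$, where $v_1\in S_1(v_0)$ is arbitrary. Then the structure of the hermitian hypergroup $H(\Gamma,v_0)=\{x_0,x_1,x_2\}$ (with unit $x_0$) is given by $$x_1\circ x_1=\frac{1}{\mu_1}x_0+\frac{m}{\mu_1}x_1+\frac{\mu_1-1-m}{\mu_1}x_2,$$ $$x_1\circ x_2=x_2\circ x_1=\frac{\mu_1-1-m}{\mu_2}x_1+\frac{\mu_2-\mu_1+1+m}{\mu_2}x_2,$$ $$x_2\circ x_2=\frac{1}{\mu_2}x_0+\left(\frac{\mu_1}{\mu_2}-\frac{\mu_1(\mu_1-1-m)}{\mu_2^2}\right)x_1+\left(1-\frac{1}{\mu_2}-\frac{\mu_1}{\mu_2}+\frac{\mu_1(\mu_1-1-m)}{\mu_2^2}\right)x_2.$$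
   Context: All graphs $\Gamma$, with vertex set $V$, are simple, connected, locally finite, self-centered (all vertices have the same eccentricity), and have at most countably many vertices. $d$ is the graph distance on $V$. A pointed graph $(\Gamma,v_0)$ is a graph with a chosen base point $v_0\in V$. For $v\in V$ and $k\in\mathbb{N}_0$, $S_k(v)=\{w\in V: d(v,w)=k\}$. Put $I(\Gamma,v_0)=\{d(v_0,v): v\in V\}$. The algebra $H(\Gamma,v_0)$: let $H(\Gamma,v_0)=\{x_i\}_{i\in I(\Gamma,v_0)}$ be a set of indeterminates and $\mathbb{C}H(\Gamma,v_0)$ the free complex vector space on it. Define a bilinear operation (convolution) $\circ$ on $\mathbb{C}H(\Gamma,v_0)$ by $x_i\circ x_j=\sum_{k\in I(\Gamma,v_0)}p_{i,j}^k x_k$, where $$p_{i,j}^k=\frac{1}{|S_i(v_0)|}\sum_{v\in S_i(v_0)}\frac{|S_j(v)\cap S_k(v_0)|}{|S_j(v)|}.$$ Let $*$ be the conjugate-linear extension to $\mathbb{C}H(\Gamma,v_0)$ of the identity map on $H(\Gamma,v_0)$. Under the hypotheses of the claim, $(H(\Gamma,v_0),\circ,* )$ is a hermitian hypergroup, i.e. $(\mathbb{C}H(\Gamma,v_0),\circ,* )$ is an associative commutative $*$-algebra with unit $x_0$ whose structure constants satisfy $p_{i,j}^k\ge0$, $\sum_k p_{i,j}^k=1$, and $p_{i,j}^0\neq0$ if and only if $i=j$. The "structure" of this hypergroup means the values of all the convolutions $x_i\circ x_j$. *)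

theory Defs
  imports
    Complex_Main
    "HOL-Library.Countable_Set"
    "HOL-Library.Extended_Nat"
    "HOL-Library.Nonpos_Ints"
    "HOL-Library.Poly_Mapping"
begin

section \<open>Graphs\<close>

definition adj_rel :: "'a set set \<Rightarrow> ('a \<times> 'a) set" where
  "adj_rel E = {(u, v). {u, v} \<in> E}"

text \<open>For vertices in different components the value is unspecified; all graphs below are
  connected.\<close>

definition gdist :: "'a set set \<Rightarrow> 'a \<Rightarrow> 'a \<Rightarrow> nat" where
  "gdist E u v = (LEAST n. (u, v) \<in> adj_rel E ^^ n)"

definition gsphere :: "'a set \<Rightarrow> 'a set set \<Rightarrow> nat \<Rightarrow> 'a \<Rightarrow> 'a set" where
  "gsphere V E k v = {w \<in> V. gdist E v w = k}"

text \<open>Infinite graphs are allowed, so an eccentricity may be infinite.\<close>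

definition eccentricity :: "'a set \<Rightarrow> 'a set set \<Rightarrow> 'a \<Rightarrow> enat" where
  "eccentricity V E v = (SUP w\<in>V. enat (gdist E v w))"

locale self_centered_graph =
  fixes V :: "'a set" and E :: "'a set set"
  assumes edges: "\<And>e. e \<in> E \<Longrightarrow> e \<subseteq> V \<and> card e = 2"
    and countable_vertices: "countable V"
    and connected: "\<And>u v. u \<in> V \<Longrightarrow> v \<in> V \<Longrightarrow> (u, v) \<in> (adj_rel E)\<^sup>*"
    and locally_finite: "\<And>v. v \<in> V \<Longrightarrow> finite {w \<in> V. {v, w} \<in> E}"
    and self_centered:
      "\<And>v w. v \<in> V \<Longrightarrow> w \<in> V \<Longrightarrow> eccentricity V E v = eccentricity V E w"

locale pointed_graph = self_centered_graph V E
  for V :: "'a set" and E :: "'a set set" +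
  fixes v0 :: 'a
  assumes base_point: "v0 \<in> V"

definition index_set :: "'a set \<Rightarrow> 'a set set \<Rightarrow> 'a \<Rightarrow> nat set" where
  "index_set V E v0 = gdist E v0 ` V"


section \<open>Free complex vector spaces and hermitian hypergroups\<close>

text \<open>The free complex vector space on indeterminates \<open>x\<^sub>i\<close>, \<open>i \<in> K\<close>, consists of the finitely
  supported functions whose support lies in \<open>K\<close>. The multiplication that \<open>poly_mapping\<close> carries
  in the library plays no role here.\<close>

definition free_space :: "'i set \<Rightarrow> ('i \<Rightarrow>\<^sub>0 complex) set" where
  "free_space K = {f. Poly_Mapping.keys f \<subseteq> K}"

definition scale :: "complex \<Rightarrow> ('i \<Rightarrow>\<^sub>0 complex) \<Rightarrow> ('i \<Rightarrow>\<^sub>0 complex)" where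
  "scale c f = Poly_Mapping.map (\<lambda>z. c * z) f"

definition indet :: "'i \<Rightarrow> ('i \<Rightarrow>\<^sub>0 complex)" where
  "indet i = Poly_Mapping.single i 1"

definition conj_star :: "('i \<Rightarrow>\<^sub>0 complex) \<Rightarrow> ('i \<Rightarrow>\<^sub>0 complex)" where
  "conj_star f = Poly_Mapping.map cnj f"

text \<open>The unit is \<open>indet e\<close>; \<open>star_indet\<close> is what makes the hypergroup hermitian.\<close>

locale hermitian_hypergroup =
  fixes K :: "'i set" and e :: 'i
    and conv :: "('i \<Rightarrow>\<^sub>0 complex) \<Rightarrow> ('i \<Rightarrow>\<^sub>0 complex) \<Rightarrow> ('i \<Rightarrow>\<^sub>0 complex)"
    and star :: "('i \<Rightarrow>\<^sub>0 complex) \<Rightarrow> ('i \<Rightarrow>\<^sub>0 complex)"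
  assumes unit_index: "e \<in> K"
    and conv_closed: "\<And>f g. f \<in> free_space K \<Longrightarrow> g \<in> free_space K \<Longrightarrow> conv f g \<in> free_space K"
    and conv_add_left: "\<And>f g h. f \<in> free_space K \<Longrightarrow> g \<in> free_space K \<Longrightarrow> h \<in> free_space K \<Longrightarrow>
          conv (f + g) h = conv f h + conv g h"
    and conv_add_right: "\<And>f g h. f \<in> free_space K \<Longrightarrow> g \<in> free_space K \<Longrightarrow> h \<in> free_space K \<Longrightarrow>
          conv f (g + h) = conv f g + conv f h"
    and conv_scale_left: "\<And>c f g. f \<in> free_space K \<Longrightarrow> g \<in> free_space K \<Longrightarrow>
          conv (scale c f) g = scale c (conv f g)"
    and conv_scale_right: "\<And>c f g. f \<in> free_space K \<Longrightarrow> g \<in> free_space K \<Longrightarrow>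
          conv f (scale c g) = scale c (conv f g)"
    and conv_assoc: "\<And>f g h. f \<in> free_space K \<Longrightarrow> g \<in> free_space K \<Longrightarrow> h \<in> free_space K \<Longrightarrow>
          conv (conv f g) h = conv f (conv g h)"
    and conv_commute: "\<And>f g. f \<in> free_space K \<Longrightarrow> g \<in> free_space K \<Longrightarrow> conv f g = conv g f"
    and conv_unit_left: "\<And>f. f \<in> free_space K \<Longrightarrow> conv (indet e) f = f"
    and conv_unit_right: "\<And>f. f \<in> free_space K \<Longrightarrow> conv f (indet e) = f"
    and star_closed: "\<And>f. f \<in> free_space K \<Longrightarrow> star f \<in> free_space K"
    and star_add: "\<And>f g. f \<in> free_space K \<Longrightarrow> g \<in> free_space K \<Longrightarrow> star (f + g) = star f + star g"
    and star_scale: "\<And>c f. f \<in> free_space K \<Longrightarrow> star (scale c f) = scale (cnj c) (star f)"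
    and star_star: "\<And>f. f \<in> free_space K \<Longrightarrow> star (star f) = f"
    and star_conv: "\<And>f g. f \<in> free_space K \<Longrightarrow> g \<in> free_space K \<Longrightarrow>
          star (conv f g) = conv (star g) (star f)"
    and star_indet: "\<And>i. i \<in> K \<Longrightarrow> star (indet i) = indet i"
    and structure_nonneg: "\<And>i j k. i \<in> K \<Longrightarrow> j \<in> K \<Longrightarrow> k \<in> K \<Longrightarrow>
          Poly_Mapping.lookup (conv (indet i) (indet j)) k \<in> \<real>\<^sub>\<ge>\<^sub>0"
    and structure_sum: "\<And>i j. i \<in> K \<Longrightarrow> j \<in> K \<Longrightarrow>
          (\<Sum>k\<in>Poly_Mapping.keys (conv (indet i) (indet j)).
             Poly_Mapping.lookup (conv (indet i) (indet j)) k) = 1"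
    and structure_unit: "\<And>i j. i \<in> K \<Longrightarrow> j \<in> K \<Longrightarrow>
          Poly_Mapping.lookup (conv (indet i) (indet j)) e \<noteq> 0 \<longleftrightarrow> i = j"


section \<open>The convolution of a pointed graph\<close>

text \<open>For a pointed graph and \<open>i\<close>, \<open>j\<close> in its index set, the denominators are positive: spheres are
  finite, and self-centeredness makes \<open>gsphere V E j v\<close> nonempty for every vertex \<open>v\<close>.\<close>

definition structure_const ::
    "'a set \<Rightarrow> 'a set set \<Rightarrow> 'a \<Rightarrow> nat \<Rightarrow> nat \<Rightarrow> nat \<Rightarrow> real" where
  "structure_const V E v0 i j k =
     1 / real (card (gsphere V E i v0)) *
     (\<Sum>v\<in>gsphere V E i v0.
        real (card (gsphere V E j v \<inter> gsphere V E k v0)) / real (card (gsphere V E j v)))"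

text \<open>The index set may be infinite, so the sum over \<open>k\<close> runs over the (finite) set of those
  indices whose coefficient does not vanish.\<close>

definition indet_conv :: "'a set \<Rightarrow> 'a set set \<Rightarrow> 'a \<Rightarrow> nat \<Rightarrow> nat \<Rightarrow> (nat \<Rightarrow>\<^sub>0 complex)" where
  "indet_conv V E v0 i j =
     (\<Sum>k | k \<in> index_set V E v0 \<and> structure_const V E v0 i j k \<noteq> 0.
        scale (complex_of_real (structure_const V E v0 i j k)) (indet k))"

definition graph_conv ::
    "'a set \<Rightarrow> 'a set set \<Rightarrow> 'a \<Rightarrow> (nat \<Rightarrow>\<^sub>0 complex) \<Rightarrow> (nat \<Rightarrow>\<^sub>0 complex) \<Rightarrow> (nat \<Rightarrow>\<^sub>0 complex)" where
  "graph_conv V E v0 f g =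
     (\<Sum>i\<in>Poly_Mapping.keys f. \<Sum>j\<in>Poly_Mapping.keys g.
        scale (Poly_Mapping.lookup f i * Poly_Mapping.lookup g j) (indet_conv V E v0 i j))"

end

theory Submission
  imports Defs
begin

text \<open>Under (S1) and (S2) the structure constant \<open>p\<^sub>i\<^sub>,\<^sub>j\<^sup>k\<close> is \<open>|S\<^sub>j(v) \<inter> S\<^sub>k(v\<^sub>0)| / |S\<^sub>j(v\<^sub>0)|\<close> for any
  \<open>v \<in> S\<^sub>i(v\<^sub>0)\<close>. Self-centeredness bounds all distances by 2, so the spheres of radius 0, 1, 2 around
  any vertex partition \<open>V\<close>; together with a double count of the edges between \<open>S\<^sub>1(v\<^sub>0)\<close> and
  \<open>S\<^sub>2(v\<^sub>0)\<close> this determines every constant from \<open>\<mu>\<^sub>1\<close>, \<open>\<mu>\<^sub>2\<close>, \<open>m\<close>. Commutativity is then visible,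
  and associativity is a finite identity between structure constants.\<close>

section \<open>Algebras given by structure constants\<close>

lemma lookup_scale [simp]: "Poly_Mapping.lookup (scale c f) k = c * Poly_Mapping.lookup f k"
  by (simp add: scale_def map.rep_eq when_def)

lemma lookup_indet: "Poly_Mapping.lookup (indet i) k = (if i = k then 1 else 0)"
  by (simp add: indet_def lookup_single when_def)

lemma lookup_conj_star [simp]:
  "Poly_Mapping.lookup (conj_star f) k = cnj (Poly_Mapping.lookup f k)"
  by (simp add: conj_star_def map.rep_eq when_def)

lemma free_space_iff: "f \<in> free_space K \<longleftrightarrow> (\<forall>k. k \<notin> K \<longrightarrow> Poly_Mapping.lookup f k = 0)"
  by (auto simp: free_space_def in_keys_iff subset_iff)

lemma indet_in_free_space: "i \<in> K \<Longrightarrow> indet i \<in> free_space K"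
  by (auto simp: free_space_iff lookup_indet)

text \<open>Only the term at \<open>(i, j)\<close> survives, so a bilinear expression evaluated on
  two indeterminates returns its coefficient. This is how structure constants are read off from
  products.\<close>

lemma sum_indet_indet:
  fixes h :: "'i \<Rightarrow> 'i \<Rightarrow> complex"
  assumes "finite A" "i \<in> A" "j \<in> A"
  shows "(\<Sum>a\<in>A. \<Sum>b\<in>A. Poly_Mapping.lookup (indet i) a * Poly_Mapping.lookup (indet j) b * h a b) = h i j"
proof -
  have "(\<Sum>a\<in>A. \<Sum>b\<in>A. Poly_Mapping.lookup (indet i) a * Poly_Mapping.lookup (indet j) b * h a b) =
      (\<Sum>a\<in>A. if i = a then \<Sum>b\<in>A. if j = b then h a b else 0 else 0)"
    by (intro sum.cong refl) (auto simp: lookup_indet intro!: sum.cong)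
  then show ?thesis using assms by simp
qed

text \<open>By bilinearity each axiom reduces to an identity between the numbers
  \<open>p i j k\<close>. It thus suffices to know the product as the bilinear extension of
  \<open>p\<close> and to check finitely many real identities and inequalities.\<close>

lemma hermitian_hypergroup_conj_starI:
  fixes K :: "'i set" and p :: "'i \<Rightarrow> 'i \<Rightarrow> 'i \<Rightarrow> real"
  assumes fin: "finite K" and e: "e \<in> K"
    and lookup_conv: "\<And>f g k. f \<in> free_space K \<Longrightarrow> g \<in> free_space K \<Longrightarrow>
      Poly_Mapping.lookup (conv f g) k =
        (if k \<in> K then \<Sum>i\<in>K. \<Sum>j\<in>K. Poly_Mapping.lookup f i * Poly_Mapping.lookup g j * of_real (p i j k)
         else 0)"
    and comm: "\<And>i j k. i \<in> K \<Longrightarrow> j \<in> K \<Longrightarrow> k \<in> K \<Longrightarrow> p i j k = p j i k"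
    and unit: "\<And>j k. j \<in> K \<Longrightarrow> k \<in> K \<Longrightarrow> p e j k = (if j = k then 1 else 0)"
    and assoc: "\<And>i j k n. i \<in> K \<Longrightarrow> j \<in> K \<Longrightarrow> k \<in> K \<Longrightarrow> n \<in> K \<Longrightarrow>
      (\<Sum>l\<in>K. p i j l * p l k n) = (\<Sum>l\<in>K. p j k l * p i l n)"
    and nonneg: "\<And>i j k. i \<in> K \<Longrightarrow> j \<in> K \<Longrightarrow> k \<in> K \<Longrightarrow> 0 \<le> p i j k"
    and total: "\<And>i j. i \<in> K \<Longrightarrow> j \<in> K \<Longrightarrow> (\<Sum>k\<in>K. p i j k) = 1"
    and diag: "\<And>i j. i \<in> K \<Longrightarrow> j \<in> K \<Longrightarrow> p i j e \<noteq> 0 \<longleftrightarrow> i = j"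
  shows "hermitian_hypergroup K e conv conj_star"
proof -
  let ?l = Poly_Mapping.lookup
  have closed: "conv f g \<in> free_space K" if "f \<in> free_space K" "g \<in> free_space K" for f g
    using that by (simp add: free_space_iff[of "conv f g"] lookup_conv)
  have add: "f + g \<in> free_space K" if "f \<in> free_space K" "g \<in> free_space K" for f g
    using that by (simp add: free_space_iff lookup_add)
  have scl: "scale c f \<in> free_space K" if "f \<in> free_space K" for c f
    using that by (simp add: free_space_iff)
  have star: "conj_star f \<in> free_space K" if "f \<in> free_space K" for f
    using that by (simp add: free_space_iff)
  have conv_indet: "?l (conv (indet i) (indet j)) k = (if k \<in> K then of_real (p i j k) else 0)"
    if "i \<in> K" "j \<in> K" for i j k
    using that fin
    by (simp add: lookup_conv indet_in_free_space sum_indet_indet)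
  have conv_commute: "conv f g = conv g f" if "f \<in> free_space K" "g \<in> free_space K" for f g
  proof (rule poly_mapping_eqI)
    fix k
    have "(\<Sum>i\<in>K. \<Sum>j\<in>K. ?l f i * ?l g j * of_real (p i j k)) =
        (\<Sum>j\<in>K. \<Sum>i\<in>K. ?l g j * ?l f i * of_real (p j i k))" if "k \<in> K"
      by (subst sum.swap) (intro sum.cong refl, simp add: comm that)
    with that show "?l (conv f g) k = ?l (conv g f) k" by (simp add: lookup_conv)
  qed
  have conv_unit: "conv (indet e) f = f" if "f \<in> free_space K" for f
  proof (rule poly_mapping_eqI)
    fix k
    have "(\<Sum>i\<in>K. \<Sum>j\<in>K. ?l (indet e) i * ?l f j * of_real (p i j k)) = ?l f k" if "k \<in> K"
    proof -
      have "(\<Sum>i\<in>K. \<Sum>j\<in>K. ?l (indet e) i * ?l f j * of_real (p i j k)) =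
          (\<Sum>i\<in>K. if e = i then \<Sum>j\<in>K. ?l f j * of_real (p i j k) else 0)"
        by (intro sum.cong refl) (simp add: lookup_indet)
      also have "\<dots> = (\<Sum>j\<in>K. ?l f j * of_real (p e j k))"
        using fin e by simp
      also have "\<dots> = (\<Sum>j\<in>K. if j = k then ?l f j else 0)"
        by (intro sum.cong refl) (simp add: unit that)
      finally show ?thesis using fin that by simp
    qed
    with that e show "?l (conv (indet e) f) k = ?l f k"
      by (cases "k \<in> K") (simp_all add: lookup_conv indet_in_free_space, simp add: free_space_iff)
  qed
  have conv_assoc: "conv (conv f g) h = conv f (conv g h)"
    if f: "f \<in> free_space K" and g: "g \<in> free_space K" and h: "h \<in> free_space K" for f g h
  proof (rule poly_mapping_eqI)
    fix n
    show "?l (conv (conv f g) h) n = ?l (conv f (conv g h)) n"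
    proof (cases "n \<in> K")
      case True
      have "?l (conv (conv f g) h) n =
          (\<Sum>l\<in>K. \<Sum>k\<in>K. \<Sum>i\<in>K. \<Sum>j\<in>K. ?l f i * ?l g j * ?l h k * of_real (p i j l * p l k n))"
        using True by (simp add: lookup_conv closed f g h sum_distrib_left sum_distrib_right mult_ac)
      \<comment> \<open>The sum over \<open>l\<close> is moved innermost, where it becomes the
        left-hand side of \<open>assoc\<close>; after \<open>assoc\<close> is applied it is moved
        out again to match the other bracketing.\<close>
      also have "\<dots> = (\<Sum>k\<in>K. \<Sum>i\<in>K. \<Sum>j\<in>K. \<Sum>l\<in>K.
          ?l f i * ?l g j * ?l h k * of_real (p i j l * p l k n))"
        by (subst sum.swap, rule sum.cong[OF refl], subst sum.swap, rule sum.cong[OF refl],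
            rule sum.swap)
      also have "\<dots> = (\<Sum>k\<in>K. \<Sum>i\<in>K. \<Sum>j\<in>K.
          ?l f i * ?l g j * ?l h k * of_real (\<Sum>l\<in>K. p i j l * p l k n))"
        by (simp add: sum_distrib_left)
      also have "\<dots> = (\<Sum>k\<in>K. \<Sum>i\<in>K. \<Sum>j\<in>K.
          ?l f i * ?l g j * ?l h k * of_real (\<Sum>l\<in>K. p j k l * p i l n))"
        by (intro sum.cong refl) (simp only: assoc True)
      also have "\<dots> = (\<Sum>i\<in>K. \<Sum>j\<in>K. \<Sum>k\<in>K.
          ?l f i * ?l g j * ?l h k * of_real (\<Sum>l\<in>K. p j k l * p i l n))"
        by (subst sum.swap, rule sum.cong[OF refl], rule sum.swap)
      also have "\<dots> = (\<Sum>i\<in>K. \<Sum>j\<in>K. \<Sum>k\<in>K. \<Sum>l\<in>K.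
          ?l f i * ?l g j * ?l h k * of_real (p j k l * p i l n))"
        by (simp add: sum_distrib_left)
      also have "\<dots> = (\<Sum>i\<in>K. \<Sum>l\<in>K. \<Sum>j\<in>K. \<Sum>k\<in>K.
          ?l f i * ?l g j * ?l h k * of_real (p j k l * p i l n))"
        by (rule sum.cong[OF refl], subst (2) sum.swap, subst sum.swap, rule refl)
      also have "\<dots> = ?l (conv f (conv g h)) n"
        using True
        by (simp add: lookup_conv closed f g h sum_distrib_left sum_distrib_right mult_ac)
      finally show ?thesis .
    qed (simp add: lookup_conv closed f g h)
  qed
  show ?thesis
  proof
    show "(\<Sum>k\<in>Poly_Mapping.keys (conv (indet i) (indet j)). ?l (conv (indet i) (indet j)) k) = 1"
      if "i \<in> K" "j \<in> K" for i j
    proof -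
      have "(\<Sum>k\<in>Poly_Mapping.keys (conv (indet i) (indet j)). ?l (conv (indet i) (indet j)) k) =
          (\<Sum>k\<in>K. ?l (conv (indet i) (indet j)) k)"
        using that fin
        by (intro sum.mono_neutral_left) (auto simp: in_keys_iff conv_indet split: if_splits)
      also have "\<dots> = of_real (\<Sum>k\<in>K. p i j k)"
        using that by (simp add: conv_indet)
      finally show ?thesis using that by (simp only: total of_real_1)
    qed
    show "?l (conv (indet i) (indet j)) k \<in> \<real>\<^sub>\<ge>\<^sub>0" if "i \<in> K" "j \<in> K" "k \<in> K" for i j k
      using that by (simp add: conv_indet nonneg)
    show "?l (conv (indet i) (indet j)) e \<noteq> 0 \<longleftrightarrow> i = j" if "i \<in> K" "j \<in> K" for i j
      using that e by (simp add: conv_indet diag)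
    show "conj_star (conv f g) = conv (conj_star g) (conj_star f)"
      if "f \<in> free_space K" "g \<in> free_space K" for f g
    proof -
      \<comment> \<open>Real structure constants are fixed by \<open>cnj\<close>, so the star is
        multiplicative; commutativity then gives the reversed order.\<close>
      have "conj_star (conv f g) = conv (conj_star f) (conj_star g)"
        using that by (intro poly_mapping_eqI) (simp add: lookup_conv star)
      then show ?thesis using that by (simp add: conv_commute star)
    qed
    show "conv f (indet e) = f" if "f \<in> free_space K" for f
      using that e by (simp add: conv_commute[of f] conv_unit indet_in_free_space)
    show "conv f g = conv g f" if "f \<in> free_space K" "g \<in> free_space K" for f g
      using that by (rule conv_commute)
    show "conv (conv f g) h = conv f (conv g h)"
      if "f \<in> free_space K" "g \<in> free_space K" "h \<in> free_space K" for f g h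
      using that by (rule conv_assoc)
  qed (use e in \<open>auto intro!: poly_mapping_eqI closed star conv_unit
      simp: lookup_conv add scl lookup_add lookup_indet algebra_simps sum.distrib sum_distrib_left\<close>)
qed

section \<open>Distances and spheres\<close>

text \<open>Edges are unordered pairs, so a walk can be traversed backwards: the induction turns its
  last edge into the first one.\<close>

lemma relpow_adj_rel_commute: "(u, v) \<in> adj_rel E ^^ n \<longleftrightarrow> (v, u) \<in> adj_rel E ^^ n"
proof -
  have "(y, x) \<in> adj_rel E ^^ n" if "(x, y) \<in> adj_rel E ^^ n" for x y
    using that
  proof (induction n arbitrary: y)
    case (Suc n)
    then obtain z where "(x, z) \<in> adj_rel E ^^ n" "(z, y) \<in> adj_rel E" by auto
    then show ?case
      using Suc.IH by (intro relpow_Suc_I2) (auto simp: adj_rel_def insert_commute)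
  qed simp
  then show ?thesis by blast
qed

lemma gdist_commute: "gdist E u v = gdist E v u"
  by (simp add: gdist_def relpow_adj_rel_commute[of u v])

lemma gdist_self [simp]: "gdist E v v = 0"
  by (simp add: gdist_def)

text \<open>The indicator depends on \<open>v\<close> and \<open>w\<close> only through their
  distance, so double counting becomes an exchange of two sums.\<close>

lemma card_sphere_Int:
  assumes "finite (gsphere V E k v0)"
  shows "card (gsphere V E j v \<inter> gsphere V E k v0) =
    (\<Sum>w\<in>gsphere V E k v0. if gdist E v w = j then 1 else 0)"
proof -
  have "gsphere V E j v \<inter> gsphere V E k v0 = {w \<in> gsphere V E k v0. gdist E v w = j}"
    by (auto simp: gsphere_def)
  then show ?thesis using assms by (simp add: sum.If_cases Int_def)
qed

context self_centered_graph
begin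

text \<open>Connectedness supplies some walk from \<open>u\<close> to \<open>v\<close>, so the least
  length in \<open>gdist\<close> is attained.\<close>

lemma relpow_gdist:
  assumes "u \<in> V" "v \<in> V"
  shows "(u, v) \<in> adj_rel E ^^ gdist E u v"
  unfolding gdist_def
  using rtrancl_imp_relpow[OF connected[OF assms]] by (auto intro: LeastI_ex)

lemma gdist_eq_0_iff: "u \<in> V \<Longrightarrow> v \<in> V \<Longrightarrow> gdist E u v = 0 \<longleftrightarrow> u = v"
  using relpow_gdist[of u v] by auto

lemma gsphere_0: "v \<in> V \<Longrightarrow> gsphere V E 0 v = {v}"
  by (auto simp: gsphere_def gdist_eq_0_iff)

text \<open>A sphere of radius \<open>k\<close> lies among the endpoints of walks of length
  \<open>k\<close>, and local finiteness bounds these by induction.\<close>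

lemma finite_gsphere:
  assumes "v \<in> V"
  shows "finite (gsphere V E k v)"
proof -
  \<comment> \<open>The inclusion in \<open>V\<close> is proved along with finiteness, since local
    finiteness applies only to vertices in \<open>V\<close>.\<close>
  have "finite {w. (v, w) \<in> adj_rel E ^^ k} \<and> {w. (v, w) \<in> adj_rel E ^^ k} \<subseteq> V"
  proof (induction k)
    case 0
    then show ?case using assms by simp
  next
    case (Suc k)
    have "{w. (v, w) \<in> adj_rel E ^^ Suc k} =
        (\<Union>u\<in>{u. (v, u) \<in> adj_rel E ^^ k}. {w \<in> V. {u, w} \<in> E})"
      using edges by (fastforce simp: adj_rel_def)
    with Suc show ?case using locally_finite by auto
  qed
  moreover have "gsphere V E k v \<subseteq> {w. (v, w) \<in> adj_rel E ^^ k}"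
    using assms relpow_gdist by (auto simp: gsphere_def)
  ultimately show ?thesis by (blast intro: finite_subset)
qed

text \<open>Both sides count the pairs \<open>(u, w)\<close> at distance \<open>j\<close> with
  \<open>u\<close> in the \<open>i\<close>-sphere and \<open>w\<close> in the
  \<open>k\<close>-sphere of \<open>v\<close>; distance is symmetric.\<close>

lemma double_count_spheres:
  assumes "v \<in> V"
  shows "(\<Sum>u\<in>gsphere V E i v. card (gsphere V E j u \<inter> gsphere V E k v)) =
    (\<Sum>w\<in>gsphere V E k v. card (gsphere V E j w \<inter> gsphere V E i v))"
  by (simp add: card_sphere_Int finite_gsphere assms, subst sum.swap) (simp add: gdist_commute)

text \<open>The index set bounds the eccentricity of \<open>v0\<close>, and self-centeredness
  carries this bound to every vertex.\<close>

lemma gdist_in_range: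
  assumes "v0 \<in> V" "index_set V E v0 = {0..n}" "u \<in> V" "w \<in> V"
  shows "gdist E u w \<le> n"
proof -
  have "enat (gdist E u w) \<le> eccentricity V E u"
    unfolding eccentricity_def using assms by (intro SUP_upper)
  also have "\<dots> = eccentricity V E v0"
    using self_centered assms by blast
  also have "\<dots> \<le> enat n"
    unfolding eccentricity_def using assms by (intro SUP_least) (auto simp: index_set_def)
  finally show ?thesis by simp
qed

text \<open>Spheres of different radii around \<open>v\<close> are disjoint, and the distance bound
  makes those up to radius \<open>n\<close> cover \<open>A\<close>.\<close>

lemma sum_card_spheres_Int:
  assumes "v \<in> V" "finite A" "A \<subseteq> V" "\<And>w. w \<in> A \<Longrightarrow> gdist E v w \<le> n"
  shows "(\<Sum>k\<le>n. card (A \<inter> gsphere V E k v)) = card A"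
proof -
  have "card A = card (\<Union>k\<in>{..n}. A \<inter> gsphere V E k v)"
    using assms by (intro arg_cong[where f = card]) (auto simp: gsphere_def)
  also have "\<dots> = (\<Sum>k\<le>n. card (A \<inter> gsphere V E k v))"
    using assms(2) by (intro card_UN_disjoint) (auto simp: gsphere_def)
  finally show ?thesis by simp
qed

end

section \<open>Structure constants and convolution of a pointed graph\<close>

lemma structure_const_eq:
  assumes "v \<in> gsphere V E i v0" "finite (gsphere V E i v0)"
    and "\<And>w. w \<in> gsphere V E i v0 \<Longrightarrow> card (gsphere V E j w) = card (gsphere V E j v0)"
    and "\<And>w. w \<in> gsphere V E i v0 \<Longrightarrow>
      card (gsphere V E j w \<inter> gsphere V E k v0) = card (gsphere V E j v \<inter> gsphere V E k v0)"
  shows "structure_const V E v0 i j k =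
    real (card (gsphere V E j v \<inter> gsphere V E k v0)) / real (card (gsphere V E j v0))"
proof -
  have "card (gsphere V E i v0) \<noteq> 0" using assms by auto
  then show ?thesis by (simp add: structure_const_def assms(3,4))
qed

text \<open>Indices outside the supports of \<open>f\<close> and \<open>g\<close> contribute zero,
  so both sums may run over the whole finite index set.\<close>

lemma lookup_graph_conv:
  assumes fin: "finite (index_set V E v0)"
    and f: "f \<in> free_space (index_set V E v0)" and g: "g \<in> free_space (index_set V E v0)"
  shows "Poly_Mapping.lookup (graph_conv V E v0 f g) k =
    (if k \<in> index_set V E v0 then
       \<Sum>i\<in>index_set V E v0. \<Sum>j\<in>index_set V E v0.
         Poly_Mapping.lookup f i * Poly_Mapping.lookup g j * of_real (structure_const V E v0 i j k)
     else 0)"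
proof -
  let ?K = "index_set V E v0" and ?l = Poly_Mapping.lookup
  \<comment> \<open>The indices left out of the sum in \<open>indet_conv\<close> have coefficient 0,
    so the formula covers them as well.\<close>
  have conv: "?l (indet_conv V E v0 i j) k =
      (if k \<in> ?K then of_real (structure_const V E v0 i j k) else 0)" for i j
    using fin by (simp add: indet_conv_def lookup_sum lookup_indet if_distrib[of "\<lambda>x. _ * x"]
        cong: if_cong)
  have "?l (graph_conv V E v0 f g) k =
      (\<Sum>i\<in>Poly_Mapping.keys f. \<Sum>j\<in>Poly_Mapping.keys g.
        ?l f i * ?l g j * ?l (indet_conv V E v0 i j) k)"
    by (simp add: graph_conv_def lookup_sum)
  also have "\<dots> = (\<Sum>i\<in>?K. \<Sum>j\<in>Poly_Mapping.keys g.
        ?l f i * ?l g j * ?l (indet_conv V E v0 i j) k)"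
    using f fin by (intro sum.mono_neutral_left) (auto simp: free_space_def in_keys_iff)
  also have "\<dots> = (\<Sum>i\<in>?K. \<Sum>j\<in>?K. ?l f i * ?l g j * ?l (indet_conv V E v0 i j) k)"
    using g fin
    by (intro sum.cong refl sum.mono_neutral_left) (auto simp: free_space_def in_keys_iff)
  finally show ?thesis by (simp add: conv)
qed

lemma lookup_graph_conv_indet:
  assumes "finite (index_set V E v0)" "i \<in> index_set V E v0" "j \<in> index_set V E v0"
  shows "Poly_Mapping.lookup (graph_conv V E v0 (indet i) (indet j)) k =
    (if k \<in> index_set V E v0 then of_real (structure_const V E v0 i j k) else 0)"
  using assms by (simp add: lookup_graph_conv indet_in_free_space sum_indet_indet)

theorem theorem4p2:
  fixes V :: "'a set" and E :: "'a set set" and v0 v1 :: 'a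
    and \<mu>1 \<mu>2 m :: real
  assumes graph: "pointed_graph V E v0"
    and index: "index_set V E v0 = {0, 1, 2}"
    and S1: "\<And>i v w. i \<in> index_set V E v0 \<Longrightarrow> v \<in> V \<Longrightarrow> w \<in> V \<Longrightarrow>
          card (gsphere V E i v) = card (gsphere V E i w)"
    and S2: "\<And>i j k v w. i \<in> index_set V E v0 \<Longrightarrow> j \<in> index_set V E v0 \<Longrightarrow>
          k \<in> index_set V E v0 \<Longrightarrow> v \<in> gsphere V E k v0 \<Longrightarrow> w \<in> gsphere V E k v0 \<Longrightarrow>
          card (gsphere V E i v \<inter> gsphere V E j v0) = card (gsphere V E i w \<inter> gsphere V E j v0)"
    and mu1: "\<mu>1 = real (card (gsphere V E 1 v0))"
    and mu2: "\<mu>2 = real (card (gsphere V E 2 v0))"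
    and v1: "v1 \<in> gsphere V E 1 v0"
    and m: "m = real (card (gsphere V E 1 v1 \<inter> gsphere V E 1 v0))"
  shows "hermitian_hypergroup (index_set V E v0) 0 (graph_conv V E v0) conj_star
         \<and> graph_conv V E v0 (indet 1) (indet 1) =
           scale (1 / \<mu>1) (indet 0) + scale (m / \<mu>1) (indet 1)
           + scale ((\<mu>1 - 1 - m) / \<mu>1) (indet 2)
         \<and> graph_conv V E v0 (indet 1) (indet 2) =
           scale ((\<mu>1 - 1 - m) / \<mu>2) (indet 1)
           + scale ((\<mu>2 - \<mu>1 + 1 + m) / \<mu>2) (indet 2)
         \<and> graph_conv V E v0 (indet 2) (indet 1) =
           scale ((\<mu>1 - 1 - m) / \<mu>2) (indet 1)
           + scale ((\<mu>2 - \<mu>1 + 1 + m) / \<mu>2) (indet 2)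
         \<and> graph_conv V E v0 (indet 2) (indet 2) =
           scale (1 / \<mu>2) (indet 0)
           + scale (\<mu>1 / \<mu>2 - \<mu>1 * (\<mu>1 - 1 - m) / \<mu>2\<^sup>2) (indet 1)
           + scale (1 - 1 / \<mu>2 - \<mu>1 / \<mu>2 + \<mu>1 * (\<mu>1 - 1 - m) / \<mu>2\<^sup>2) (indet 2)"
proof -
  interpret pointed_graph V E v0 by (fact graph)

  \<comment> \<open>Intersection numbers of spheres\<close>
  let ?K = "index_set V E v0" and ?S = "gsphere V E" and ?p = "structure_const V E v0"
  \<comment> \<open>These counts are the numerators of the structure constants; they are real-valued
    so that they can be subtracted freely.\<close>
  define n where "n v j k = real (card (?S j v \<inter> ?S k v0))" for v j k
  note v0 = base_point
  \<comment> \<open>Keeps the index 1 from turning into \<open>Suc 0\<close>, so that the facts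
    about radius 1 still match.\<close>
  note [simp del] = One_nat_def
  have fin: "finite (?S k v)" if "v \<in> V" for k v
    using finite_gsphere that .
  have SV: "?S k v \<subseteq> V" for k v by (auto simp: gsphere_def)
  have v1V: "v1 \<in> V" using v1 SV by blast
  have "2 \<in> gdist E v0 ` V" using index by (auto simp: index_set_def)
  then obtain v2 where v2: "v2 \<in> ?S 2 v0" and v2V: "v2 \<in> V" by (auto simp: gsphere_def)
  have d01: "gdist E v0 v1 = 1" "gdist E v0 v2 = 2" using v1 v2 by (auto simp: gsphere_def)
  have d10: "gdist E v1 v0 = 1" "gdist E v2 v0 = 2" using d01 gdist_commute by metis+
  have pos: "\<mu>1 > 0" "\<mu>2 > 0"
    using v1 v2 fin v0 by (auto simp: mu1 mu2 card_gt_0_iff)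
  have diam: "gdist E u w \<le> 2" if "u \<in> V" "w \<in> V" for u w
  proof (rule gdist_in_range[OF v0 _ that])
    show "?K = {0..2}" unfolding index by auto
  qed
  \<comment> \<open>The spheres around \<open>v0\<close> cut the \<open>j\<close>-sphere of
    \<open>v\<close> into three pieces; by (S1) its size does not depend on
    \<open>v\<close>.\<close>
  have row: "n v j 0 + n v j 1 + n v j 2 = real (card (?S j v0))" if "v \<in> V" "j \<in> ?K" for v j
  proof -
    have "(\<Sum>k\<le>2. card (?S j v \<inter> ?S k v0)) = card (?S j v)"
      using that v0 SV fin by (intro sum_card_spheres_Int) (auto intro: diam)
    also have "\<dots> = card (?S j v0)" using S1 that v0 by blast
    finally show ?thesis unfolding n_def by (simp flip: of_nat_add add: numeral_2_eq_2 One_nat_def)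
  qed
  \<comment> \<open>Dually, the spheres around \<open>v\<close> cut the \<open>k\<close>-sphere of
    \<open>v0\<close>.\<close>
  have col: "n v 0 k + n v 1 k + n v 2 k = real (card (?S k v0))" if "v \<in> V" for v k
  proof -
    have "(\<Sum>j\<le>2. card (?S k v0 \<inter> ?S j v)) = card (?S k v0)"
      using that v0 SV fin by (intro sum_card_spheres_Int) (auto intro: diam)
    then show ?thesis unfolding n_def by (simp flip: of_nat_add
        add: numeral_2_eq_2 One_nat_def Int_commute)
  qed
  have p_eq: "?p i j k = n v j k / real (card (?S j v0))"
    if "v \<in> ?S i v0" "i \<in> ?K" "j \<in> ?K" "k \<in> ?K" for v i j k
    unfolding n_def
  proof (rule structure_const_eq)
    show "card (?S j w) = card (?S j v0)" if "w \<in> ?S i v0" for w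
      using S1 \<open>j \<in> ?K\<close> v0 SV that by blast
    show "card (?S j w \<inter> ?S k v0) = card (?S j v \<inter> ?S k v0)" if "w \<in> ?S i v0" for w
      using S2 that \<open>v \<in> ?S i v0\<close> \<open>i \<in> ?K\<close> \<open>j \<in> ?K\<close> \<open>k \<in> ?K\<close> by blast
  qed (use that v0 fin in auto)
  have n_at_v0: "n v j 0 = (if gdist E v v0 = j then 1 else 0)" for v j
    using v0 by (simp add: n_def gsphere_0) (simp add: gsphere_def)
  have n_0: "n v 0 k = (if gdist E v0 v = k then 1 else 0)" if "v \<in> V" for v k
    using that by (simp add: n_def gsphere_0) (simp add: gsphere_def)

  \<comment> \<open>The base point is the only vertex of \<open>?S 0 v0\<close>, and
    \<open>m\<close> counts the neighbours inside \<open>?S 1 v0\<close>; the row sum leaves the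
    third value.\<close>
  have n11: "n v1 1 0 = 1" "n v1 1 1 = m" "n v1 1 2 = \<mu>1 - 1 - m"
    using row[OF v1V, of 1] by (auto simp: n_at_v0 d10 m mu1 index n_def[of v1 1 1])
  \<comment> \<open>The column sum over \<open>?S 1 v0\<close>, in which \<open>v1\<close> itself
    contributes 1, gives the middle value; the row sum gives the last.\<close>
  have n12: "n v1 2 0 = 0" "n v1 2 1 = \<mu>1 - 1 - m" "n v1 2 2 = \<mu>2 - (\<mu>1 - 1 - m)"
    using row[OF v1V, of 2] col[OF v1V, of 1] n11
    by (auto simp: n_at_v0 n_0 v1V d01 d10 mu1 mu2 index)
  \<comment> \<open>Edges between the two spheres are counted from either side. By (S2) both sums
    have constant terms, which yields \<open>n v2 1 1\<close>.\<close>
  have "(\<Sum>u\<in>?S 1 v0. n u 1 2) = (\<Sum>w\<in>?S 2 v0. n w 1 1)"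
    unfolding n_def using double_count_spheres[OF v0, of 1 1 2] by (simp flip: of_nat_sum)
  moreover have "n u 1 2 = n v1 1 2" if "u \<in> ?S 1 v0" for u
    unfolding n_def using S2[of 1 2 1 u v1] that v1 index by auto
  moreover have "n w 1 1 = n v2 1 1" if "w \<in> ?S 2 v0" for w
    unfolding n_def using S2[of 1 1 2 w v2] that v2 index by auto
  ultimately have edges_12: "\<mu>1 * (\<mu>1 - 1 - m) = \<mu>2 * n v2 1 1"
    using n11 by (simp add: mu1 mu2)
  then have n21: "n v2 1 0 = 0" "n v2 1 1 = \<mu>1 * (\<mu>1 - 1 - m) / \<mu>2"
      "n v2 1 2 = \<mu>1 - \<mu>1 * (\<mu>1 - 1 - m) / \<mu>2"
    using row[OF v2V, of 1] pos by (auto simp: n_at_v0 d10 mu1 index field_simps)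
  have n22: "n v2 2 0 = 1" "n v2 2 1 = \<mu>1 - \<mu>1 * (\<mu>1 - 1 - m) / \<mu>2"
      "n v2 2 2 = \<mu>2 - 1 - \<mu>1 + \<mu>1 * (\<mu>1 - 1 - m) / \<mu>2"
    using row[OF v2V, of 2] col[OF v2V, of 1] n21
    by (auto simp: n_at_v0 n_0 v2V d01 d10 mu1 mu2 index)

  \<comment> \<open>Structure constants as polynomials\<close>
  define a where "a = 1 / \<mu>1"
  define b where "b = 1 / \<mu>2"
  define N where "N = \<mu>1 - 1 - m"
  \<comment> \<open>With the reciprocals \<open>a\<close> and \<open>b\<close>, every structure
    constant becomes a polynomial in \<open>a\<close>, \<open>b\<close>, \<open>c\<close> and
    \<open>N\<close>. Here \<open>N\<close> is the number of neighbours in \<open>?S 2 v0\<close> of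
    a vertex of \<open>?S 1 v0\<close>, and \<open>c\<close> is the value of
    \<open>?p 2 2 1\<close>.\<close>
  define c where "c = \<mu>1 * b * (1 - N * b)"
  \<comment> \<open>Associativity holds modulo this single relation.\<close>
  have ac: "a * c = b * (1 - N * b)" using pos by (simp add: a_def c_def)
  have p0: "?p 0 j k = (if j = k then 1 else 0)" if "j \<in> ?K" "k \<in> ?K" for j k
  proof -
    have "\<exists>w. w \<in> ?S j v0"
      using that(1) by (auto simp: index_set_def gsphere_def)
    then have "card (?S j v0) \<noteq> 0"
      using fin[OF v0] by auto
    moreover have "?S j v0 \<inter> ?S k v0 = (if j = k then ?S j v0 else {})"
      by (auto simp: gsphere_def)
    moreover have "?p 0 j k = n v0 j k / real (card (?S j v0))"
      using that v0 by (intro p_eq) (simp_all add: gsphere_0 index)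
    ultimately show ?thesis
      by (cases "j = k") (simp_all add: n_def)
  qed
  have p_0: "?p 1 0 k = (if 1 = k then 1 else 0)" "?p 2 0 k = (if 2 = k then 1 else 0)"
    if "k \<in> ?K" for k
    using that v0
    by (simp_all add: p_eq[OF v1] p_eq[OF v2] n_0 v1V v2V d01 index gsphere_0)
  have p11: "?p 1 1 0 = a" "?p 1 1 1 = 1 - a - N * a" "?p 1 1 2 = N * a"
    using pos by (simp_all add: p_eq[OF v1] index n11 a_def N_def field_simps flip: mu1)
  have p12: "?p 1 2 0 = 0" "?p 1 2 1 = N * b" "?p 1 2 2 = 1 - N * b"
    using pos
    by (simp_all add: p_eq[OF v1] index n12 b_def N_def field_simps flip: mu2)
  have p21: "?p 2 1 0 = 0" "?p 2 1 1 = N * b" "?p 2 1 2 = 1 - N * b"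
    using pos
    by (simp_all add: p_eq[OF v2] index n21 b_def N_def field_simps flip: mu1)
  have p22: "?p 2 2 0 = b" "?p 2 2 1 = c" "?p 2 2 2 = 1 - b - c"
    using pos
    by (simp_all add: p_eq[OF v2] index n22 b_def c_def N_def field_simps power2_eq_square
        flip: mu2)
  note pvals = p0[unfolded index] p_0[unfolded index] p11 p12 p21 p22

  \<comment> \<open>Hypergroup axioms and product formulas\<close>
  have finK: "finite ?K" by (simp add: index)
  have "hermitian_hypergroup ?K 0 (graph_conv V E v0) conj_star"
  proof (rule hermitian_hypergroup_conj_starI[where p = ?p])
    show "?p i j k = ?p j i k" if "i \<in> ?K" "j \<in> ?K" "k \<in> ?K" for i j k
      using that unfolding index by (auto simp: pvals)
    \<comment> \<open>All index choices are expanded at once into polynomial identities.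
      Cancellation rules are removed because they would turn these equations into
      disjunctions.\<close>
    have "\<forall>i\<in>?K. \<forall>j\<in>?K. \<forall>k\<in>?K. \<forall>n\<in>?K.
        (\<Sum>l\<in>?K. ?p i j l * ?p l k n) = (\<Sum>l\<in>?K. ?p j k l * ?p i l n)"
      unfolding index
      by (simp add: pvals del: mult_cancel_left mult_cancel_right)
        (intro conjI; use ac in algebra)
    then show "(\<Sum>l\<in>?K. ?p i j l * ?p l k n) = (\<Sum>l\<in>?K. ?p j k l * ?p i l n)"
      if "i \<in> ?K" "j \<in> ?K" "k \<in> ?K" "n \<in> ?K" for i j k n
      using that by blast
    show "0 \<le> ?p i j k" for i j k
      by (auto simp: structure_const_def intro!: divide_nonneg_nonneg sum_nonneg)
    show "(\<Sum>k\<in>?K. ?p i j k) = 1" if "i \<in> ?K" "j \<in> ?K" for i j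
      using that unfolding index by (auto simp: pvals)
    show "?p i j 0 \<noteq> 0 \<longleftrightarrow> i = j" if "i \<in> ?K" "j \<in> ?K" for i j
      using that pos unfolding index by (auto simp: pvals a_def b_def)
  qed (use lookup_graph_conv[OF finK] p0 in \<open>auto simp: index\<close>)
  moreover have "graph_conv V E v0 (indet i) (indet j) = scale (?p i j 0) (indet 0)
      + scale (?p i j 1) (indet 1) + scale (?p i j 2) (indet 2)" if "i \<in> ?K" "j \<in> ?K" for i j
    using that by (intro poly_mapping_eqI)
      (auto simp: lookup_graph_conv_indet[OF finK] lookup_add lookup_indet index)
  \<comment> \<open>Removes the unit term from the mixed products, whose coefficient at
    \<open>indet 0\<close> vanishes.\<close>
  moreover have "scale 0 f = 0" for f :: "nat \<Rightarrow>\<^sub>0 complex"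
    by (rule poly_mapping_eqI) simp
  moreover have "?p 1 1 0 = 1 / \<mu>1" "?p 1 1 1 = m / \<mu>1" "?p 1 1 2 = (\<mu>1 - 1 - m) / \<mu>1"
      "?p 1 2 1 = (\<mu>1 - 1 - m) / \<mu>2" "?p 1 2 2 = (\<mu>2 - \<mu>1 + 1 + m) / \<mu>2"
      "?p 2 1 1 = (\<mu>1 - 1 - m) / \<mu>2" "?p 2 1 2 = (\<mu>2 - \<mu>1 + 1 + m) / \<mu>2"
    using pos by (simp_all add: p11 p12 p21 a_def b_def N_def field_simps)
  moreover have "?p 2 2 0 = 1 / \<mu>2" "?p 2 2 1 = \<mu>1 / \<mu>2 - \<mu>1 * (\<mu>1 - 1 - m) / \<mu>2\<^sup>2"
      "?p 2 2 2 = 1 - 1 / \<mu>2 - \<mu>1 / \<mu>2 + \<mu>1 * (\<mu>1 - 1 - m) / \<mu>2\<^sup>2"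
    by (simp_all add: p22 b_def c_def N_def algebra_simps diff_divide_distrib power2_eq_square)
  ultimately show ?thesis
    by (simp add: index p12(1) p21(1))
qed

end
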